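(* For any prime $p\equiv 1\pmod 4$, we have $$\left(\frac{\sqrt{D_p^{(1)}}}{p}\right)=(-1)^{\left|\left\{0<k<\frac p4:\ \left(\frac kp\right)=-1\right\}\right|}\left(\frac p3\right),$$ where $k$ ranges over integers.
   Context: For an odd prime $p$, $$D_p^{(1)}=\det\left[(i^2-j^2)\left(\frac{i^2-j^2}{p}\right)\right]_{1\le i,j\le (p-1)/2},$$ where $\left(\frac{\cdot}{p}\right)$ is the Legendre symbol modulo $p$ (equal to $0$ on multiples of $p$). When $p\equiv 1\pmod 4$, the matrix is an integer skew-symmetric matrix of even order, so by Cayley's theorem $D_p^{(1)}$ is the square of an integer; $\sqrt{D_p^{(1)}}$ denotes its (nonnegative) integer square root. $\left(\frac p3\right)$ is the Legendre symbol modulo $3$. *)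

theory Defs
  imports "HOL-Number_Theory.Number_Theory" "Jordan_Normal_Form.Determinant"
begin

(* The entries of "mat" are indexed from 0, so the index i of the matrix,
   which runs over 1, ..., (p - 1) / 2, appears as Suc i. *)
definition D1_mat :: "nat \<Rightarrow> int mat" where
  "D1_mat p = mat ((p - 1) div 2) ((p - 1) div 2)
     (\<lambda>(i, j). let d = (int (Suc i))\<^sup>2 - (int (Suc j))\<^sup>2 in d * Legendre d (int p))"

definition D1 :: "nat \<Rightarrow> int" where
  "D1 p = det (D1_mat p)"

(* The exact nonnegative integer square root; it is unspecified unless n is a perfect square
   (no rounding takes place). *)
definition int_sqrt :: "int \<Rightarrow> int" where
  "int_sqrt n = (THE s. 0 \<le> s \<and> s\<^sup>2 = n)"

lemma int_sqrt_power2: "0 \<le> s \<Longrightarrow> int_sqrt (s\<^sup>2) = s"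
  unfolding int_sqrt_def by (rule the_equality) (auto simp: power2_eq_iff_nonneg)

end

theory Submission
  imports Defs
begin

text \<open>
  Write \<open>p = 4m + 1\<close>, \<open>n = 2m\<close> and \<open>x\<^sub>i = i\<^sup>2\<close>. By Euler's criterion the matrix is congruent modulo \<open>p\<close> to
  \<open>((x\<^sub>i - x\<^sub>j)\<^sup>n\<^sup>+\<^sup>1)\<close>. Since \<open>x\<^sub>i\<^sup>n\<close> is 1 modulo \<open>p\<close>, the binomial theorem turns the entries into
  \<open>x\<^sub>j \<Sum>\<^sub>a \<gamma>\<^sub>a x\<^sub>i\<^sup>a x\<^sub>j\<^sup>-\<^sup>a\<close> with \<open>a\<close> running over the residues modulo \<open>n\<close>, so the matrix factors through
  the Vandermonde matrices of the \<open>x\<^sub>i\<close> and of their inverses. Hence the determinant is congruent to the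
  square of \<open>V (n + 2) \<Prod> (n + 1 choose k)\<close>, where \<open>V\<close> is the Vandermonde determinant of the \<open>x\<^sub>i\<close> and
  \<open>k\<close> ranges over \<open>2, \<dots>, m\<close>. As \<open>-1\<close> is a quadratic residue, the sign of a square root is irrelevant to
  its Legendre symbol. By Wilson's theorem and pairing of factors, everything in that of the above root
  cancels except the symbols of \<open>m!\<close> and of 3.
\<close>

section \<open>Determinants\<close>

lemma det_mat_scale_rows:
  fixes f :: "nat \<Rightarrow> nat \<Rightarrow> 'a :: comm_ring_1"
  shows "det (mat n n (\<lambda>(i, j). c i * f i j)) = (\<Prod>i<n. c i) * det (mat n n (\<lambda>(i, j). f i j))"
proof -
  have "det (mat n n (\<lambda>(i, j). c i * f i j)) =
      (\<Sum>\<pi> | \<pi> permutes {0..<n}. signof \<pi> * (\<Prod>i = 0..<n. c i * f i (\<pi> i)))"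
    by (subst det_def'[of _ n]) (auto intro!: sum.cong prod.cong dest: permutes_in_image)
  also have "\<dots> = (\<Prod>i<n. c i) * (\<Sum>\<pi> | \<pi> permutes {0..<n}. signof \<pi> * (\<Prod>i = 0..<n. f i (\<pi> i)))"
    by (simp add: prod.distrib sum_distrib_left lessThan_atLeast0 ac_simps)
  also have "(\<Sum>\<pi> | \<pi> permutes {0..<n}. signof \<pi> * (\<Prod>i = 0..<n. f i (\<pi> i))) =
      det (mat n n (\<lambda>(i, j). f i j))"
    by (subst det_def'[of _ n]) (auto intro!: sum.cong prod.cong dest: permutes_in_image)
  finally show ?thesis .
qed

lemma det_mat_transpose:
  fixes f :: "nat \<Rightarrow> nat \<Rightarrow> 'a :: comm_ring_1"
  shows "det (mat n n (\<lambda>(i, j). f j i)) = det (mat n n (\<lambda>(i, j). f i j))"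
proof -
  have "mat n n (\<lambda>(i, j). f j i) = transpose_mat (mat n n (\<lambda>(i, j). f i j))"
    by auto
  then show ?thesis
    using det_transpose[of "mat n n (\<lambda>(i, j). f i j)" n] by simp
qed

lemma det_mat_zero_row:
  fixes f :: "nat \<Rightarrow> nat \<Rightarrow> 'a :: comm_ring_1"
  assumes "k < n" and "\<And>j. j < n \<Longrightarrow> f k j = 0"
  shows "det (mat n n (\<lambda>(i, j). f i j)) = 0"
proof -
  have "det (mat n n (\<lambda>(i, j). f i j)) = (\<Sum>j<n. f k j * cofactor (mat n n (\<lambda>(i, j). f i j)) k j)"
    using laplace_expansion_row[of "mat n n (\<lambda>(i, j). f i j)" n k] assms(1) by simp
  then show ?thesis
    using assms(2) by simp
qed

lemma det_mat_first_row:
  fixes f :: "nat \<Rightarrow> nat \<Rightarrow> 'a :: comm_ring_1"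
  assumes "\<And>j. j < n \<Longrightarrow> f 0 (Suc j) = 0"
  shows "det (mat (Suc n) (Suc n) (\<lambda>(i, j). f i j)) =
    f 0 0 * det (mat n n (\<lambda>(i, j). f (Suc i) (Suc j)))"
proof -
  let ?A = "mat (Suc n) (Suc n) (\<lambda>(i, j). f i j)"
  have "det ?A = (\<Sum>j<Suc n. ?A $$ (0, j) * cofactor ?A 0 j)"
    by (rule laplace_expansion_row) auto
  also have "\<dots> = f 0 0 * cofactor ?A 0 0"
    by (subst sum.lessThan_Suc_shift) (simp add: assms)
  also have "mat_delete ?A 0 0 = mat n n (\<lambda>(i, j). f (Suc i) (Suc j))"
    by (rule eq_matI) (auto simp: mat_delete_def)
  hence "cofactor ?A 0 0 = det (mat n n (\<lambda>(i, j). f (Suc i) (Suc j)))"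
    by (simp add: cofactor_def)
  finally show ?thesis .
qed

lemma det_mat_2:
  fixes f :: "nat \<Rightarrow> nat \<Rightarrow> 'a :: comm_ring_1"
  shows "det (mat 2 2 (\<lambda>(i, j). f i j)) = f 0 0 * f 1 1 - f 0 1 * f 1 0"
proof -
  let ?A = "mat 2 2 (\<lambda>(i, j). f i j)"
  have "det ?A = (\<Sum>j<2. ?A $$ (0, j) * cofactor ?A 0 j)"
    by (rule laplace_expansion_row) auto
  also have "\<dots> = f 0 0 * det (mat_delete ?A 0 0) - f 0 1 * det (mat_delete ?A 0 1)"
    by (simp add: numeral_2_eq_2 cofactor_def)
  also have "\<dots> = f 0 0 * f 1 1 - f 0 1 * f 1 0"
    by (simp add: mat_delete_def det_single)
  finally show ?thesis .
qed

lemma mat_times_mat: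
  fixes f g :: "nat \<Rightarrow> nat \<Rightarrow> 'a :: semiring_0"
  shows "mat n l (\<lambda>(i, k). f i k) * mat l m (\<lambda>(k, j). g k j) =
    mat n m (\<lambda>(i, j). \<Sum>k<l. f i k * g k j)"
  by (rule eq_matI) (auto simp: scalar_prod_def lessThan_atLeast0 intro!: sum.cong)

lemma det_cong_mod:
  fixes f g :: "nat \<Rightarrow> nat \<Rightarrow> int"
  assumes "\<And>i j. i < n \<Longrightarrow> j < n \<Longrightarrow> [f i j = g i j] (mod q)"
  shows "[det (mat n n (\<lambda>(i, j). f i j)) = det (mat n n (\<lambda>(i, j). g i j))] (mod q)"
proof -
  have "[(\<Sum>\<pi> | \<pi> permutes {0..<n}. signof \<pi> * (\<Prod>i = 0..<n. mat n n (\<lambda>(i, j). f i j) $$ (i, \<pi> i))) =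
      (\<Sum>\<pi> | \<pi> permutes {0..<n}. signof \<pi> * (\<Prod>i = 0..<n. mat n n (\<lambda>(i, j). g i j) $$ (i, \<pi> i)))] (mod q)"
    by (intro cong_sum cong_mult cong_prod cong_refl) (auto dest: permutes_in_image intro!: assms)
  then show ?thesis
    by (simp add: det_def'[of _ n])
qed

section \<open>Vandermonde determinants\<close>

lemma det_vandermonde:
  fixes x :: "nat \<Rightarrow> 'a :: comm_ring_1"
  shows "det (mat n n (\<lambda>(i, j). x i ^ j)) = (\<Prod>j<n. \<Prod>i<j. x j - x i)"
proof (induction n arbitrary: x)
  case 0
  then show ?case by simp
next
  case (Suc n)
  let ?V = "mat (Suc n) (Suc n) (\<lambda>(i, j). x i ^ j)"
  \<comment> \<open>\<open>u\<close> is the unipotent column operation that subtracts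
    \<open>x 0\<close> times each column from the next one. It clears the first row beyond its
    leading 1 and leaves a Vandermonde matrix with scaled rows.\<close>
  define u where "u k j = (if k = j then 1 else if Suc k = j then - x 0 else 0)" for k j
  let ?U = "mat (Suc n) (Suc n) (\<lambda>(k, j). u k j)"
  define w where "w i j = (case j of 0 \<Rightarrow> 1 | Suc j' \<Rightarrow> (x i - x 0) * x i ^ j')" for i j
  have "det ?U = prod_list (diag_mat ?U)"
    by (rule det_upper_triangular[of _ "Suc n"]) (auto simp: u_def)
  also have "\<dots> = 1"
    unfolding prod_list_diag_prod by (simp add: u_def)
  finally have "det ?V = det (?V * ?U)"
    by (subst det_mult[of _ "Suc n"]) auto
  also have "?V * ?U = mat (Suc n) (Suc n) (\<lambda>(i, j). w i j)"
  proof -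
    have "(\<Sum>k<Suc n. x i ^ k * u k j) = w i j" if "j < Suc n" for i j
    proof (cases j)
      case 0
      have "(\<Sum>k<Suc n. x i ^ k * u k j) = (\<Sum>k\<in>{0}. x i ^ k * u k j)"
        by (rule sum.mono_neutral_right) (auto simp: u_def 0)
      then show ?thesis by (simp add: u_def w_def 0)
    next
      case (Suc j')
      have "(\<Sum>k<Suc n. x i ^ k * u k j) = (\<Sum>k\<in>{j', Suc j'}. x i ^ k * u k j)"
        using that by (intro sum.mono_neutral_right) (auto simp: u_def Suc)
      then show ?thesis by (simp add: u_def w_def Suc algebra_simps)
    qed
    then show ?thesis
      unfolding mat_times_mat by (intro eq_matI) auto
  qed
  also have "det \<dots> = det (mat n n (\<lambda>(i, j). (x (Suc i) - x 0) * x (Suc i) ^ j))"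
    by (subst det_mat_first_row) (auto simp: w_def)
  also have "\<dots> = (\<Prod>i<n. x (Suc i) - x 0) * (\<Prod>j<n. \<Prod>i<j. x (Suc j) - x (Suc i))"
    by (simp add: det_mat_scale_rows Suc.IH)
  also have "\<dots> = (\<Prod>j<Suc n. \<Prod>i<j. x j - x i)"
    by (simp add: prod.lessThan_Suc_shift prod.distrib del: prod.lessThan_Suc)
  finally show ?case .
qed

text \<open>The matrix factors as the Vandermonde matrix of \<open>x\<close>, the diagonal matrix of
  \<open>\<gamma>\<close>, the transposed Vandermonde matrix of \<open>y\<close> and the diagonal
  matrix of \<open>z\<close>.\<close>

lemma det_power_kernel:
  fixes x y z \<gamma> :: "nat \<Rightarrow> 'a :: comm_ring_1"
  shows "det (mat n n (\<lambda>(i, j). z j * (\<Sum>a<n. \<gamma> a * x i ^ a * y j ^ a))) =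
    (\<Prod>j<n. z j) * (\<Prod>a<n. \<gamma> a) * (\<Prod>j<n. \<Prod>i<j. x j - x i) * (\<Prod>j<n. \<Prod>i<j. y j - y i)"
proof -
  have "mat n n (\<lambda>(i, j). z j * (\<Sum>a<n. \<gamma> a * x i ^ a * y j ^ a)) =
      mat n n (\<lambda>(i, a). x i ^ a) * mat n n (\<lambda>(a, j). \<gamma> a * (z j * y j ^ a))"
    unfolding mat_times_mat by (intro eq_matI) (auto simp: sum_distrib_left ac_simps)
  also have "det \<dots> = det (mat n n (\<lambda>(i, a). x i ^ a)) * det (mat n n (\<lambda>(a, j). \<gamma> a * (z j * y j ^ a)))"
    by (rule det_mult) auto
  also have "det (mat n n (\<lambda>(a, j). \<gamma> a * (z j * y j ^ a))) =
      (\<Prod>a<n. \<gamma> a) * det (mat n n (\<lambda>(j, a). z j * y j ^ a))"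
    by (simp only: det_mat_scale_rows det_mat_transpose[of n "\<lambda>j a. z j * y j ^ a"])
  finally show ?thesis
    by (simp add: det_mat_scale_rows det_vandermonde ac_simps)
qed

section \<open>Determinants of alternating matrices\<close>

lemma det_mat_permute:
  fixes f :: "nat \<Rightarrow> nat \<Rightarrow> 'a :: comm_ring_1"
  assumes "\<pi> permutes {0..<n}"
  shows "det (mat n n (\<lambda>(i, j). f (\<pi> i) (\<pi> j))) = det (mat n n (\<lambda>(i, j). f i j))"
proof -
  have rows: "det (mat n n (\<lambda>(i, j). g (\<pi> i) j)) = signof \<pi> * det (mat n n (\<lambda>(i, j). g i j))"
    for g :: "nat \<Rightarrow> nat \<Rightarrow> 'a"
  proof -
    have "mat n n (\<lambda>(i, j). g (\<pi> i) j) = mat n n (\<lambda>(i, j). mat n n (\<lambda>(i, j). g i j) $$ (\<pi> i, j))"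
      using assms by (intro eq_matI) (auto dest: permutes_in_image)
    then show ?thesis
      using det_permute_rows[OF _ assms, of "mat n n (\<lambda>(i, j). g i j)"] by simp
  qed
  \<comment> \<open>The sign of \<open>\<pi>\<close> enters once for the rows and once for the
    columns, so it cancels.\<close>
  have "det (mat n n (\<lambda>(i, j). f (\<pi> i) (\<pi> j))) = signof \<pi> * det (mat n n (\<lambda>(i, j). f i (\<pi> j)))"
    by (rule rows)
  also have "det (mat n n (\<lambda>(i, j). f i (\<pi> j))) = det (mat n n (\<lambda>(j, i). f i (\<pi> j)))"
    by (rule det_mat_transpose)
  also have "\<dots> = signof \<pi> * det (mat n n (\<lambda>(j, i). f i j))"
    by (rule rows)
  also have "det (mat n n (\<lambda>(j, i). f i j)) = det (mat n n (\<lambda>(i, j). f i j))"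
    by (rule det_mat_transpose)
  finally show ?thesis
    by (simp add: sign_def)
qed

text \<open>Block elimination with the leading 2 by 2 block J, which is invertible with determinant
  \<open>(f 0 1)\<^sup>2\<close>. The remaining matrix is the Schur complement D - C J^(-1)
  B.\<close>

lemma det_schur_complement_alternating:
  fixes f :: "nat \<Rightarrow> nat \<Rightarrow> 'a :: field"
  assumes "f 0 0 = 0" "f 1 1 = 0" "f 1 0 = - f 0 1" and a: "f 0 1 \<noteq> 0"
  shows "det (mat (n + 2) (n + 2) (\<lambda>(i, j). f i j)) = (f 0 1)\<^sup>2 *
    det (mat n n (\<lambda>(i, j). f (i + 2) (j + 2) +
      (f (i + 2) 0 * f 1 (j + 2) - f (i + 2) 1 * f 0 (j + 2)) / f 0 1))"
proof -
  \<comment> \<open>This is -C J^(-1), the multiplier that clears the lower left block.\<close>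
  define k where "k i j = (if j = 0 then - f (i + 2) 1 else f (i + 2) 0) / f 0 1" for i j :: nat
  let ?J = "mat 2 2 (\<lambda>(i, j). f i j)"
  let ?B = "mat 2 n (\<lambda>(i, j). f i (j + 2))"
  let ?C = "mat n 2 (\<lambda>(i, j). f (i + 2) j)"
  let ?D = "mat n n (\<lambda>(i, j). f (i + 2) (j + 2))"
  let ?K = "mat n 2 (\<lambda>(i, j). k i j)"
  let ?S = "mat n n (\<lambda>(i, j). f (i + 2) (j + 2) +
      (f (i + 2) 0 * f 1 (j + 2) - f (i + 2) 1 * f 0 (j + 2)) / f 0 1)"
  let ?L = "four_block_mat (1\<^sub>m 2) (0\<^sub>m 2 n) ?K (1\<^sub>m n)"
  let ?A = "mat (n + 2) (n + 2) (\<lambda>(i, j). f i j)"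
  have two: "{..<2} = {0, Suc 0}" by auto
  have A: "?A = four_block_mat ?J ?B ?C ?D"
  proof -
    have "Suc (Suc (i - 2)) = i" if "\<not> i < 2" for i
      using that by simp
    then show ?thesis
      by (intro eq_matI) auto
  qed
  have KJ: "?K * ?J + ?C * 1\<^sub>m 2 = 0\<^sub>m n 2"
  proof -
    have "?K * ?J + ?C = 0\<^sub>m n 2"
      unfolding mat_times_mat using assms
      by (intro eq_matI) (auto simp: k_def two less_2_cases_iff)
    then show ?thesis by simp
  qed
  have KB: "?K * ?B + ?D = ?S"
    unfolding mat_times_mat using assms
    by (intro eq_matI) (auto simp: k_def two field_simps)
  have "det ?L = 1"
    by (subst det_four_block_mat_upper_right_zero[of _ 2 _ n]) auto
  then have "det ?A = det (?L * ?A)"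
    by (subst det_mult[of _ "n + 2"]) auto
  also have "?L * ?A = four_block_mat ?J ?B (?K * ?J + ?C) (?K * ?B + ?D)"
    unfolding A by (subst mult_four_block_mat[of _ 2 2 _ n _ n]) auto
  also have "\<dots> = four_block_mat ?J ?B (0\<^sub>m n 2) ?S"
    using KJ KB by simp
  also have "det \<dots> = det ?J * det ?S"
    by (rule det_four_block_mat_lower_left_zero) auto
  also have "det ?J = (f 0 1)\<^sup>2"
  proof -
    have "f 0 0 * f 1 1 - f 0 1 * f 1 0 = (f 0 1)\<^sup>2"
      using assms by (simp add: power2_eq_square)
    then show ?thesis
      by (simp only: det_mat_2)
  qed
  finally show ?thesis .
qed

text \<open>Elimination removes two indices at a time: each stage splits off a square, and the Schur
  complement is again alternating. The zero diagonal is assumed separately because antisymmetry does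
  not imply it in characteristic 2.\<close>

theorem det_alternating_is_square:
  fixes f :: "nat \<Rightarrow> nat \<Rightarrow> 'a :: field"
  assumes "\<And>i. f i i = 0" and "\<And>i j. f j i = - f i j"
  shows "\<exists>s. det (mat n n (\<lambda>(i, j). f i j)) = s\<^sup>2"
  using assms
proof (induction n arbitrary: f rule: less_induct)
  case (less n)
  consider "n = 0" | "n > 0" "\<forall>j<n. f 0 j = 0" | j where "j < n" "f 0 j \<noteq> 0"
    by blast
  then show ?case
  proof cases
    case 1
    then show ?thesis by (auto intro: exI[of _ 1])
  next
    case 2
    then have "det (mat n n (\<lambda>(i, j). f i j)) = 0"
      by (intro det_mat_zero_row[of 0]) auto
    then show ?thesis by (auto intro: exI[of _ 0])
  next
    case (3 j)
    with less.prems have "j \<noteq> 0" by metis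
    with 3 obtain m where n: "n = m + 2"
      by (metis add_2_eq_Suc' gr0_conv_Suc less_Suc_eq_0_disj less_antisym not0_implies_Suc not_less_eq)
    \<comment> \<open>Swapping 1 and \<open>j\<close> in both rows and columns brings the nonzero
      entry to position (0, 1), where it can serve as the pivot.\<close>
    define \<pi> where "\<pi> = Transposition.transpose 1 j"
    define g where "g i k = f (\<pi> i) (\<pi> k)" for i k
    have "\<pi> permutes {0..<n}"
      unfolding \<pi>_def using 3 n by (intro permutes_swap_id) auto
    then have fg: "det (mat n n (\<lambda>(i, j). f i j)) = det (mat n n (\<lambda>(i, j). g i j))"
      unfolding g_def by (rule det_mat_permute[symmetric])
    have g: "g i i = 0" "g k i = - g i k" for i k
      using less.prems unfolding g_def by blast+
    have "g 0 1 \<noteq> 0"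
      using 3 \<open>j \<noteq> 0\<close> by (auto simp: g_def \<pi>_def transpose_def)
    define h where "h i k = g (i + 2) (k + 2) + (g (i + 2) 0 * g 1 (k + 2) - g (i + 2) 1 * g 0 (k + 2)) / g 0 1"
      for i k
    have "det (mat n n (\<lambda>(i, j). g i j)) = (g 0 1)\<^sup>2 * det (mat m m (\<lambda>(i, j). h i j))"
      unfolding n h_def
      by (rule det_schur_complement_alternating) (rule g \<open>g 0 1 \<noteq> 0\<close>)+
    moreover have "\<exists>s. det (mat m m (\<lambda>(i, j). h i j)) = s\<^sup>2"
    proof (rule less.IH)
      show "m < n" using n by simp
      show "h i i = 0" for i
        using g(1)[of "i + 2"] g(2)[of "i + 2" 0] g(2)[of "i + 2" 1] by (simp add: h_def)
      show "h k i = - h i k" for i k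
      proof -
        have "g (k + 2) (i + 2) = - g (i + 2) (k + 2)" "g (k + 2) 0 = - g 0 (k + 2)"
          "g (k + 2) 1 = - g 1 (k + 2)" "g (i + 2) 0 = - g 0 (i + 2)" "g (i + 2) 1 = - g 1 (i + 2)"
          by (rule g(2))+
        then show ?thesis
          unfolding h_def by (simp only:) (simp add: algebra_simps diff_divide_distrib)
      qed
    qed
    ultimately show ?thesis
      unfolding fg by (metis power_mult_distrib)
  qed
qed

text \<open>The denominator b of the root satisfies b^2 dvd a^2, hence b dvd a, so the root is an
  integer.\<close>

lemma int_square_if_rat_square:
  fixes d :: int and r :: rat
  assumes "of_int d = r\<^sup>2"
  shows "\<exists>s. d = s\<^sup>2"
proof -
  obtain a b where ab: "quotient_of r = (a, b)" by fastforce
  then have b: "b > 0" and r: "r = of_int a / of_int b"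
    using quotient_of_denom_pos quotient_of_div by auto
  from assms have "(of_int (d * b\<^sup>2) :: rat) = of_int (a\<^sup>2)"
    using b by (simp add: r field_simps)
  then have eq: "d * b\<^sup>2 = a\<^sup>2"
    by (simp only: of_int_eq_iff)
  then have "b\<^sup>2 dvd a\<^sup>2" by (metis dvd_triv_right)
  then have "b dvd a" by simp
  then obtain c where "a = b * c" ..
  with eq b have "d = c\<^sup>2" by (simp add: power_mult_distrib)
  then show ?thesis ..
qed

text \<open>Elimination divides by the pivot, so it is carried out over the rationals, and the
  square root is then brought back to the integers.\<close>

theorem int_det_alternating_is_square:
  fixes f :: "nat \<Rightarrow> nat \<Rightarrow> int"
  assumes "\<And>i. f i i = 0" and "\<And>i j. f j i = - f i j"
  shows "\<exists>s. det (mat n n (\<lambda>(i, j). f i j)) = s\<^sup>2"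
proof -
  let ?A = "mat n n (\<lambda>(i, j). f i j)"
  have "(of_int (det ?A) :: rat) = det (map_mat of_int ?A)"
    by simp
  also have "map_mat of_int ?A = mat n n (\<lambda>(i, j). (of_int (f i j) :: rat))"
    by auto
  finally have "(of_int (det ?A) :: rat) = det (mat n n (\<lambda>(i, j). of_int (f i j)))" .
  moreover have "\<exists>s. det (mat n n (\<lambda>(i, j). of_int (f i j) :: rat)) = s\<^sup>2"
    by (rule det_alternating_is_square) (metis assms(1) of_int_0, metis assms(2) of_int_minus)
  ultimately show ?thesis
    using int_square_if_rat_square by metis
qed

section \<open>Products and congruences\<close>

text \<open>Pairs complementary factors: equal binomial coefficients in one use, factorials linked
  by Wilson's theorem in another.\<close>

lemma prod_lessThan_fold:
  fixes f :: "nat \<Rightarrow> 'a :: comm_monoid_mult"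
  shows "(\<Prod>k<2 * m. f k) = (\<Prod>k<m. f k * f (2 * m - 1 - k))"
proof -
  have "{..<2 * m} = {..<m} \<union> {m..<2 * m}" by auto
  then have "(\<Prod>k<2 * m. f k) = (\<Prod>k<m. f k) * (\<Prod>k = m..<2 * m. f k)"
    by (simp add: prod.union_disjoint ivl_disj_int)
  also have "(\<Prod>k = m..<2 * m. f k) = (\<Prod>k<m. f (2 * m - 1 - k))"
    by (rule prod.reindex_bij_witness[of _ "\<lambda>k. 2 * m - 1 - k" "\<lambda>k. 2 * m - 1 - k"]) auto
  finally show ?thesis by (simp add: prod.distrib)
qed

lemma prod_lessThan_alternating_sign: "(\<Prod>j<2 * m. (- 1) ^ j) = ((- 1) ^ m :: 'a :: comm_ring_1)"
  by (induction m) simp_all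

text \<open>For inverse nodes, x_i x_j (y_j - y_i) is congruent to -(x_j - x_i). Over all pairs each
  x_j occurs n - 1 times; one more factor x_j on both sides avoids the truncated exponent.\<close>

lemma vandermonde_inverse_cong:
  fixes x y :: "nat \<Rightarrow> int"
  assumes "\<And>j. j < n \<Longrightarrow> [x j * y j = 1] (mod q)"
  shows "[(\<Prod>j<n. x j) ^ n * (\<Prod>j<n. \<Prod>i<j. y j - y i) =
    (\<Prod>j<n. (- 1) ^ j) * (\<Prod>j<n. x j) * (\<Prod>j<n. \<Prod>i<j. x j - x i)] (mod q)"
  using assms
proof (induction n)
  case 0
  then show ?case by simp
next
  case (Suc n)
  let ?X = "\<Prod>j<n. x j"
  have "[x n * x i * (y n - y i) = - 1 * (x n - x i)] (mod q)" if "i < n" for i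
  proof -
    have "x n * x i * (y n - y i) = x i * (x n * y n) - x n * (x i * y i)"
      by (simp add: algebra_simps)
    also have "[\<dots> = x i * 1 - x n * 1] (mod q)"
      using that by (intro cong_diff cong_mult cong_refl Suc.prems) auto
    finally show ?thesis by simp
  qed
  then have "[(\<Prod>i<n. x n * x i * (y n - y i)) = (\<Prod>i<n. - 1 * (x n - x i))] (mod q)"
    by (intro cong_prod) auto
  then have step: "[x n ^ n * ?X * (\<Prod>i<n. y n - y i) = (- 1) ^ n * (\<Prod>i<n. x n - x i)] (mod q)"
    by (simp only: prod.distrib prod_constant card_lessThan)
  have "(\<Prod>j<Suc n. x j) ^ Suc n * (\<Prod>j<Suc n. \<Prod>i<j. y j - y i) =
      (?X ^ n * (\<Prod>j<n. \<Prod>i<j. y j - y i)) * (x n ^ n * ?X * (\<Prod>i<n. y n - y i)) * x n"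
    by (simp add: power_mult_distrib ac_simps)
  also have "[\<dots> = ((\<Prod>j<n. (- 1) ^ j) * ?X * (\<Prod>j<n. \<Prod>i<j. x j - x i)) *
      ((- 1) ^ n * (\<Prod>i<n. x n - x i)) * x n] (mod q)"
    using Suc.prems by (intro cong_mult Suc.IH step cong_refl) auto
  finally show ?case
    by (simp add: ac_simps)
qed

section \<open>Factorials, Wilson's theorem and binomial coefficients\<close>

lemma prod_rising_mult_fact:
  "(\<Prod>i<k. int (b + 1 + i)) * fact b = fact (b + k)"
proof (induction k)
  case 0
  then show ?case by simp
next
  case (Suc k)
  have "(\<Prod>i<Suc k. int (b + 1 + i)) * fact b = int (b + 1 + k) * ((\<Prod>i<k. int (b + 1 + i)) * fact b)"
    by simp
  also have "\<dots> = fact (b + Suc k)"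
    unfolding Suc.IH by simp
  finally show ?case .
qed

text \<open>Factoring (j+1)^2 - (i+1)^2 = (j-i)(i+j+2) gives (2j+1)!/(j+1) as the product over i <
  j. The denominators multiply to n!.\<close>

lemma vandermonde_squares_mult_fact:
  "(\<Prod>j<n. \<Prod>i<j. (int (Suc j))\<^sup>2 - (int (Suc i))\<^sup>2) * fact n = (\<Prod>j<n. fact (2 * j + 1))"
proof (induction n)
  case 0
  then show ?case by simp
next
  case (Suc n)
  have "(int (Suc n))\<^sup>2 - (int (Suc i))\<^sup>2 = int (n - i) * int (n + 1 + 1 + i)" if "i < n" for i
    using that by (simp add: of_nat_diff power2_eq_square algebra_simps)
  then have "(\<Prod>i<n. (int (Suc n))\<^sup>2 - (int (Suc i))\<^sup>2) * int (Suc n) =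
      (\<Prod>i<n. int (n - i)) * (\<Prod>i<n. int (n + 1 + 1 + i)) * int (Suc n)"
    unfolding prod.distrib[symmetric] by (intro arg_cong2[where f = "(*)"] prod.cong) auto
  also have "(\<Prod>i<n. int (n - i)) = fact n"
    by (simp add: fact_prod_rev lessThan_atLeast0)
  also have "fact n * (\<Prod>i<n. int (n + 1 + 1 + i)) * int (Suc n) =
      (\<Prod>i<n. int (n + 1 + 1 + i)) * fact (n + 1)"
    by simp
  also have "\<dots> = fact (2 * n + 1)"
    using prod_rising_mult_fact[where b = "n + 1" and k = n]
    by (simp only: add.commute[of "n + 1" n] add.assoc[symmetric] mult_2)
  finally have row: "(\<Prod>i<n. (int (Suc n))\<^sup>2 - (int (Suc i))\<^sup>2) * int (Suc n) = fact (2 * n + 1)" .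
  have "(\<Prod>j<Suc n. \<Prod>i<j. (int (Suc j))\<^sup>2 - (int (Suc i))\<^sup>2) * fact (Suc n) =
      ((\<Prod>j<n. \<Prod>i<j. (int (Suc j))\<^sup>2 - (int (Suc i))\<^sup>2) * fact n) *
      ((\<Prod>i<n. (int (Suc n))\<^sup>2 - (int (Suc i))\<^sup>2) * int (Suc n))"
    by (simp only: prod.lessThan_Suc fact_Suc of_nat_id ac_simps)
  then show ?case
    unfolding Suc.IH row by simp
qed

text \<open>Wilson's theorem is the case k = 0. Each step trades a factor r + 1 for k + 1, which is
  congruent to -(r + 1), so the sign flips.\<close>

lemma fact_mult_fact_complement_cong:
  assumes "prime p" "k < p"
  shows "[fact k * fact (p - 1 - k) = (- 1) ^ Suc k] (mod int p)"
  using assms(2)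
proof (induction k)
  case 0
  then show ?case using wilson_theorem[OF assms(1)] by simp
next
  case (Suc k)
  define r where "r = p - 1 - Suc k"
  have p: "int p = int k + 1 + int (Suc r)" and r: "p - 1 - k = Suc r"
    using Suc.prems by (auto simp: r_def)
  have IH: "[fact k * fact (Suc r) = (- 1) ^ Suc k] (mod int p)"
    using Suc.IH Suc.prems unfolding r by simp
  have "fact (Suc k) * fact r = - (fact k * fact (Suc r)) + int p * (fact k * fact r)"
    unfolding p by (simp add: algebra_simps)
  also have "[\<dots> = - ((- 1) ^ Suc k) + 0] (mod int p)"
    by (intro cong_add iffD2[OF cong_minus_minus_iff] IH) (simp add: cong_0_iff)
  finally show ?case by (simp add: r_def)
qed

text \<open>Exponents of \<open>x\<close> count only modulo \<open>n\<close>, so in the binomial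
  expansion the terms 0 and \<open>n\<close> merge, as do the terms 1 and \<open>n + 1\<close>. Each
  merged coefficient is (n + 1) + 1, whence the exceptional value \<open>n + 2\<close> for a < 2.
  The power \<open>z ^ (n - 1)\<close> is the inverse of \<open>z\<close>.\<close>

lemma binomial_power_kernel_cong:
  fixes x z :: int
  assumes "even n" "n \<ge> 2" and x: "[x ^ n = 1] (mod q)" and z: "[z ^ n = 1] (mod q)"
  shows "[(x - z) ^ Suc n = z * (\<Sum>a<n. ((- 1) ^ Suc a * int (if a < 2 then n + 2 else Suc n choose a)) *
    x ^ a * (z ^ (n - 1)) ^ a)] (mod q)"
proof -
  obtain N where N: "n = N + 2"
    using \<open>n \<ge> 2\<close> by (metis le_add_diff_inverse2)
  have "even N" using \<open>even n\<close> N by simp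
  let ?b = "\<lambda>k. int (Suc n choose k) * x ^ k * (- z) ^ (Suc n - k)"
  have "(x - z) ^ Suc n = (\<Sum>k\<le>Suc n. ?b k)"
    using binomial_ring[of x "- z" "Suc n"] by (simp only: diff_conv_add_uminus of_nat_id)
  also have "\<dots> = ?b 0 + ?b 1 + (\<Sum>k<N. ?b (k + 2)) + ?b n + ?b (Suc n)"
  proof -
    have "(\<Sum>k\<le>Suc (N + 2). g k) = g 0 + g 1 + (\<Sum>k<N. g (k + 2)) + g (N + 2) + g (Suc (N + 2))"
      for g :: "nat \<Rightarrow> int"
      by (induction N) (simp_all add: numeral_2_eq_2)
    then show ?thesis
      unfolding N .
  qed
  also have "\<dots> = - (z ^ n * z) + int (Suc n) * x * z ^ n + (\<Sum>k<N. ?b (k + 2)) +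
      - (int (Suc n) * x ^ n * z) + x ^ n * x"
  proof -
    have "?b 0 = - (z ^ n * z)" "?b 1 = int (Suc n) * x * z ^ n" "?b n = - (int (Suc n) * x ^ n * z)"
        "?b (Suc n) = x ^ n * x"
      using \<open>even n\<close> by simp_all
    then show ?thesis by (simp only:)
  qed
  finally have e1: "(x - z) ^ Suc n = - (z ^ n * z) + int (Suc n) * x * z ^ n + (\<Sum>k<N. ?b (k + 2)) +
      - (int (Suc n) * x ^ n * z) + x ^ n * x" .
  have c1: "[- (z ^ n * z) + int (Suc n) * x * z ^ n + (\<Sum>k<N. ?b (k + 2)) +
      - (int (Suc n) * x ^ n * z) + x ^ n * x =
      - (1 * z) + int (Suc n) * x * 1 + (\<Sum>k<N. ?b (k + 2)) + - (int (Suc n) * 1 * z) + 1 * x] (mod q)"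
    by (intro cong_add cong_mult cong_refl x z cong_minus_minus_iff[THEN iffD2])
  have e2: "- (1 * z) + int (Suc n) * x * 1 + (\<Sum>k<N. ?b (k + 2)) + - (int (Suc n) * 1 * z) + 1 * x =
      - (z * int (n + 2)) + x * 1 * int (n + 2) + (\<Sum>k<N. ?b (k + 2))"
    by (simp add: algebra_simps)
  have cs: "[(\<Sum>k<N. ?b (k + 2)) = (\<Sum>k<N. ((- 1) ^ Suc k *
      int (Suc n choose (k + 2))) * x ^ (k + 2) * (z * (z ^ (n - 1)) ^ (k + 2)))] (mod q)"
  proof (rule cong_sum)
    fix k assume "k \<in> {..<N}"
    then obtain r where r: "N = k + r" "r > 0" by (metis lessThan_iff less_imp_add_positive)
    \<comment> \<open>The exponents of \<open>z\<close> on the two sides differ by a multiple of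
      \<open>n\<close>.\<close>
    have e: "Suc n - (k + 2) = Suc r" "1 + (n - 1) * (k + 2) = Suc r + n * Suc k"
      using r by (simp_all add: N algebra_simps)
    have "z * (z ^ (n - 1)) ^ (k + 2) = z ^ (1 + (n - 1) * (k + 2))"
      by (simp only: power_add power_mult power_one_right)
    also have "\<dots> = z ^ Suc r * (z ^ n) ^ Suc k"
      unfolding e by (simp only: power_add power_mult)
    also have "[\<dots> = z ^ Suc r * 1 ^ Suc k] (mod q)"
      by (intro cong_mult cong_refl cong_pow z)
    finally have zz: "[z * (z ^ (n - 1)) ^ (k + 2) = z ^ Suc r] (mod q)" by simp
    \<comment> \<open>As k + r = \<open>N\<close> is even, k and r have the same parity.\<close>
    have "(- z) ^ Suc r = (- 1) ^ Suc k * z ^ Suc r"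
      using \<open>even N\<close> r by (cases "even k") (auto simp: power_minus_odd)
    then have "?b (k + 2) = ((- 1) ^ Suc k * int (Suc n choose (k + 2))) * x ^ (k + 2) * z ^ Suc r"
      unfolding e by (simp only: ac_simps)
    also have "[\<dots> = ((- 1) ^ Suc k * int (Suc n choose (k + 2))) * x ^ (k + 2) *
        (z * (z ^ (n - 1)) ^ (k + 2))] (mod q)"
      by (intro cong_mult cong_refl cong_sym[OF zz])
    finally show "[?b (k + 2) = ((- 1) ^ Suc k * int (Suc n choose (k + 2))) * x ^ (k + 2) *
        (z * (z ^ (n - 1)) ^ (k + 2))] (mod q)" .
  qed
  \<comment> \<open>The factor 1 beside \<open>x\<close> is turned back into \<open>z ^ n\<close> =
    \<open>z * z ^ (n - 1)\<close>, so that \<open>z\<close> can be pulled out of the term a =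
    1.\<close>
  have c2: "[- (z * int (n + 2)) + x * 1 * int (n + 2) + (\<Sum>k<N. ?b (k + 2)) =
      - (z * int (n + 2)) + x * z ^ n * int (n + 2) + (\<Sum>k<N. ((- 1) ^ Suc k *
      int (Suc n choose (k + 2))) * x ^ (k + 2) * (z * (z ^ (n - 1)) ^ (k + 2)))] (mod q)"
    by (intro cong_add cong_mult[OF cong_mult] cong_refl cs cong_sym[OF z])
  have e3: "- (z * int (n + 2)) + x * z ^ n * int (n + 2) + (\<Sum>k<N. ((- 1) ^ Suc k *
      int (Suc n choose (k + 2))) * x ^ (k + 2) * (z * (z ^ (n - 1)) ^ (k + 2))) =
      z * (\<Sum>a<n. ((- 1) ^ Suc a * int (if a < 2 then n + 2 else Suc n choose a)) * x ^ a * (z ^ (n - 1)) ^ a)"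
  proof -
    have "z ^ n = z * z ^ (n - 1)" using N by simp
    moreover have "(\<Sum>a<n. g a) = g 0 + g 1 + (\<Sum>k<N. g (k + 2))" for g :: "nat \<Rightarrow> int"
      by (simp add: N sum.lessThan_Suc_shift del: sum.lessThan_Suc)
    ultimately show ?thesis
      by (simp add: distrib_left right_diff_distrib sum_distrib_left ac_simps del: binomial_Suc_Suc)
  qed
  show ?thesis
    using cong_trans[OF c1[unfolded e2] c2] unfolding e1 e3 .
qed

text \<open>The indices 0 and 1 give equal factors, and a -> 2m + 1 - a exchanges 2, ..., m with m +
  1, ..., 2m - 1. Apart from the sign the product is therefore a square.\<close>

lemma binomial_coefficient_prod:
  assumes "m = Suc q"
  shows "(\<Prod>a<2 * m. (- 1) ^ Suc a * int (if a < 2 then 2 * m + 2 else Suc (2 * m) choose a)) =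
    (- 1) ^ m * (int (2 * m + 2) * (\<Prod>k<q. int (Suc (2 * m) choose (k + 2))))\<^sup>2"
proof -
  let ?c = "\<lambda>a. int (if a < 2 then 2 * m + 2 else Suc (2 * m) choose a)"
  have "(\<Prod>a<2 * m. ?c a) = ?c 0 * (?c 1 * (\<Prod>k<2 * q. ?c (k + 2)))"
    by (simp add: assms prod.lessThan_Suc_shift del: prod.lessThan_Suc)
  also have "(\<Prod>k<2 * q. ?c (k + 2)) = (\<Prod>k<q. ?c (k + 2) * ?c (2 * q - 1 - k + 2))"
    by (rule prod_lessThan_fold)
  also have "\<dots> = (\<Prod>k<q. (int (Suc (2 * m) choose (k + 2)))\<^sup>2)"
  proof (rule prod.cong)
    fix k assume k: "k \<in> {..<q}"
    have "Suc (2 * m) choose (k + 2) = Suc (2 * m) choose (Suc (2 * m) - (k + 2))"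
      using k by (intro binomial_symmetric) (simp add: assms)
    also have "Suc (2 * m) - (k + 2) = 2 * q - 1 - k + 2"
      using k by (simp add: assms)
    finally show "?c (k + 2) * ?c (2 * q - 1 - k + 2) = (int (Suc (2 * m) choose (k + 2)))\<^sup>2"
      by (simp add: power2_eq_square)
  qed simp
  finally have "(\<Prod>a<2 * m. ?c a) = (int (2 * m + 2) * (\<Prod>k<q. int (Suc (2 * m) choose (k + 2))))\<^sup>2"
    by (simp add: power2_eq_square prod.distrib del: binomial_Suc_Suc)
  moreover have "(\<Prod>a<2 * m. (- 1) ^ Suc a) = ((- 1) ^ m :: int)"
    by (induction m) simp_all
  ultimately show ?thesis
    by (simp only: prod.distrib)
qed

section \<open>The Legendre symbol\<close>

text \<open>Two numbers in {-1, 0, 1} differ by at most 2, so congruences between Legendre symbols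
  become equalities.\<close>

lemma cong_imp_eq_of_abs_le_1:
  fixes u v q :: int
  assumes "q > 2" "[u = v] (mod q)" "\<bar>u\<bar> \<le> 1" "\<bar>v\<bar> \<le> 1"
  shows "u = v"
proof (rule ccontr)
  assume "u \<noteq> v"
  then have "\<bar>q\<bar> \<le> \<bar>u - v\<bar>"
    using assms(2) by (intro dvd_imp_le_int) (auto simp: cong_iff_dvd_diff)
  with assms show False by linarith
qed

lemma abs_Legendre_le_1: "\<bar>Legendre a q\<bar> \<le> 1"
  by (simp add: Legendre_def)

lemma Legendre_eqI:
  assumes "prime p" "2 < p" "[u = a ^ ((p - 1) div 2)] (mod int p)" "\<bar>u\<bar> \<le> 1"
  shows "Legendre a (int p) = u"
  using assms euler_criterion[OF assms(1,2), of a]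
  by (intro cong_imp_eq_of_abs_le_1[of "int p"]) (auto intro: cong_trans cong_sym abs_Legendre_le_1)

lemma Legendre_cong:
  assumes "prime p" "2 < p" "[a = b] (mod int p)"
  shows "Legendre a (int p) = Legendre b (int p)"
  using assms
  by (intro Legendre_eqI cong_trans[OF euler_criterion] cong_pow abs_Legendre_le_1) (auto intro: cong_sym)

lemma Legendre_mult:
  assumes "prime p" "2 < p"
  shows "Legendre (a * b) (int p) = Legendre a (int p) * Legendre b (int p)"
proof (rule Legendre_eqI[OF assms])
  show "[Legendre a (int p) * Legendre b (int p) = (a * b) ^ ((p - 1) div 2)] (mod int p)"
    unfolding power_mult_distrib by (intro cong_mult euler_criterion assms)
  show "\<bar>Legendre a (int p) * Legendre b (int p)\<bar> \<le> 1"
    unfolding abs_mult by (intro mult_le_one abs_Legendre_le_1) auto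
qed

lemma Legendre_1: "prime p \<Longrightarrow> 2 < p \<Longrightarrow> Legendre 1 (int p) = 1"
  by (rule Legendre_eqI) auto

lemma Legendre_prod:
  assumes "prime p" "2 < p"
  shows "Legendre (\<Prod>i\<in>S. f i) (int p) = (\<Prod>i\<in>S. Legendre (f i) (int p))"
  by (induction S rule: infinite_finite_induct) (simp_all add: Legendre_1 Legendre_mult assms)

lemma Legendre_unit:
  "\<not> int p dvd a \<Longrightarrow> Legendre a (int p) = 1 \<or> Legendre a (int p) = - 1"
  by (auto simp: Legendre_def cong_0_iff)

lemma Legendre_unit_square:
  "\<not> int p dvd a \<Longrightarrow> Legendre a (int p) * Legendre a (int p) = 1"
  using Legendre_unit by fastforce

lemma not_dvd_fact_int: "prime p \<Longrightarrow> k < p \<Longrightarrow> \<not> int p dvd fact k"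
  by (metis int_dvd_int_iff not_le of_nat_fact prime_dvd_fact_iff)

text \<open>Since (2k+1)! (2k+2)! = ((2k+1)!)^2 * 2(k+1), each pair of consecutive factorials
  contributes only the symbols of 2 and k + 1.\<close>

lemma Legendre_prod_fact:
  assumes "prime p" "2 < p" "2 * m < p"
  shows "(\<Prod>k<2 * m. Legendre (fact (k + 1)) (int p)) =
    Legendre 2 (int p) ^ m * Legendre (fact m) (int p)"
  using assms(3)
proof (induction m)
  case 0
  then show ?case by (simp add: Legendre_1 assms)
next
  case (Suc m)
  have fact: "fact (2 * m + 2) = 2 * int (Suc m) * fact (2 * m + 1)" "fact (Suc m) = int (Suc m) * fact m"
    by (simp_all add: algebra_simps)
  have "Legendre (fact (2 * m + 1)) (int p) * Legendre (fact (2 * m + 2)) (int p) =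
      Legendre 2 (int p) * Legendre (int (Suc m)) (int p) *
      (Legendre (fact (2 * m + 1)) (int p) * Legendre (fact (2 * m + 1)) (int p))"
    unfolding fact by (simp only: Legendre_mult assms ac_simps)
  also have "Legendre (fact (2 * m + 1)) (int p) * Legendre (fact (2 * m + 1)) (int p) = 1"
    using Suc.prems by (intro Legendre_unit_square not_dvd_fact_int assms) simp
  finally have "Legendre (fact (2 * m + 1)) (int p) * Legendre (fact (2 * m + 2)) (int p) =
      Legendre 2 (int p) * Legendre (int (Suc m)) (int p)" by simp
  moreover have "(\<Prod>k<2 * Suc m. Legendre (fact (k + 1)) (int p)) =
      (\<Prod>k<2 * m. Legendre (fact (k + 1)) (int p)) *
      (Legendre (fact (2 * m + 1)) (int p) * Legendre (fact (2 * m + 2)) (int p))"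
    by (simp del: fact_Suc)
  moreover have "Legendre (fact (Suc m)) (int p) = Legendre (int (Suc m)) (int p) * Legendre (fact m) (int p)"
    unfolding fact by (simp only: Legendre_mult assms)
  ultimately show ?case
    using Suc by (simp add: ac_simps del: fact_Suc)
qed

text \<open>By multiplicativity each nonresidue up to \<open>m\<close> contributes one factor -1; as
  m < p, no factor vanishes.\<close>

lemma Legendre_fact_eq_sign:
  assumes "prime p" "2 < p" "m < p"
  shows "Legendre (fact m) (int p) = (- 1) ^ card {k. 0 < k \<and> k \<le> m \<and> Legendre (int k) (int p) = - 1}"
  using assms(3)
proof (induction m)
  case 0
  have "{k. 0 < k \<and> k \<le> (0::nat) \<and> Legendre (int k) (int p) = - 1} = {}" by auto
  then show ?case by (simp only:) (simp add: Legendre_1 assms)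
next
  case (Suc m)
  let ?S = "\<lambda>m. {k. 0 < k \<and> k \<le> m \<and> Legendre (int k) (int p) = - 1}"
  have fin: "finite (?S m)" by (rule finite_subset[of _ "{..m}"]) auto
  have "\<not> int p dvd int (Suc m)"
    using Suc.prems by (auto dest: dvd_imp_le simp only: int_dvd_int_iff)
  then consider "Legendre (int (Suc m)) (int p) = 1" "?S (Suc m) = ?S m"
    | "Legendre (int (Suc m)) (int p) = - 1" "?S (Suc m) = insert (Suc m) (?S m)"
    using Legendre_unit[of p "int (Suc m)"] by (fastforce simp: le_Suc_eq)
  moreover have "Legendre (fact (Suc m)) (int p) = Legendre (int (Suc m)) (int p) * Legendre (fact m) (int p)"
    by (simp only: fact_Suc of_nat_id Legendre_mult assms)
  ultimately show ?case
    using Suc fin by cases (simp_all del: fact_Suc of_nat_Suc)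
qed

section \<open>The determinant modulo p\<close>

lemma square_fact_half_cong:
  assumes "prime p" "p = 4 * m + 1"
  shows "[(fact (2 * m))\<^sup>2 = - 1] (mod int p)"
  using fact_mult_fact_complement_cong[OF assms(1), of "2 * m"] assms(2)
  by (simp add: power2_eq_square)

text \<open>Passing to the inverse nodes produces the sign (-1)^m, and so does the product of the
  coefficients; the two cancel and leave a square.\<close>

lemma D1_cong_square:
  assumes p: "prime p" and pm: "p = 4 * m + 1" and mq: "m = Suc q"
  shows "[D1 p = ((\<Prod>j<2 * m. \<Prod>i<j. (int (Suc j))\<^sup>2 - (int (Suc i))\<^sup>2) *
    (int (2 * m + 2) * (\<Prod>k<q. int (Suc (2 * m) choose (k + 2)))))\<^sup>2] (mod int p)"
proof -
  define n where "n = 2 * m"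
  define x where "x i = (int (Suc i))\<^sup>2" for i
  define y where "y i = x i ^ (n - 1)" for i
  define \<gamma> where "\<gamma> a = (- 1) ^ Suc a * int (if a < 2 then n + 2 else Suc n choose a)" for a
  define V where "V w = (\<Prod>j<n. \<Prod>i<j. w j - w i)" for w :: "nat \<Rightarrow> int"
  define c where "c = int (n + 2) * (\<Prod>k<q. int (Suc n choose (k + 2)))"
  define X where "X = (\<Prod>j<n. x j)"
  have p2: "2 < p" and half: "(p - 1) div 2 = n" and n: "n \<ge> 2" "even n"
    using pm mq by (auto simp: n_def)
  \<comment> \<open>By Fermat, since \<open>x i ^ n\<close> is the power of i + 1 with exponent 2n =
    p - 1.\<close>
  have xn: "[x i ^ n = 1] (mod int p)" if "i < n" for i
  proof -
    have "\<not> p dvd Suc i"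
      using that pm by (auto simp: n_def dest: dvd_imp_le)
    then have "[Suc i ^ (p - 1) = 1] (mod p)"
      by (rule fermat_theorem[OF p])
    then have "[int (Suc i ^ (p - 1)) = int 1] (mod int p)"
      by (simp only: cong_int_iff)
    moreover have "p - 1 = 2 * n" using pm by (simp add: n_def)
    ultimately show ?thesis
      by (simp add: x_def power_mult)
  qed
  have entry: "[(let d = (int (Suc i))\<^sup>2 - (int (Suc j))\<^sup>2 in d * Legendre d (int p)) =
      x j * (\<Sum>a<n. \<gamma> a * x i ^ a * y j ^ a)] (mod int p)" if "i < n" "j < n" for i j
  proof -
    have "[(x i - x j) * Legendre (x i - x j) (int p) = (x i - x j) * (x i - x j) ^ n] (mod int p)"
      using euler_criterion[OF p p2, of "x i - x j"] unfolding half by (intro cong_mult cong_refl)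
    moreover have "[(x i - x j) ^ Suc n = x j * (\<Sum>a<n. \<gamma> a * x i ^ a * y j ^ a)] (mod int p)"
      unfolding y_def \<gamma>_def by (rule binomial_power_kernel_cong[OF n(2,1) xn xn]) (use that in auto)
    ultimately show ?thesis
      unfolding Let_def x_def[symmetric] power_Suc by (rule cong_trans)
  qed
  \<comment> \<open>Here \<open>X\<close> = (n!)^2 is congruent to -1 and \<open>n\<close> is even,
    so both \<open>X ^ n\<close> and \<open>X * X\<close> become 1.\<close>
  have XV: "[X * V y = (- 1) ^ m * V x] (mod int p)"
  proof -
    have "X = (fact n)\<^sup>2"
      unfolding X_def x_def
      by (simp add: fact_prod_Suc lessThan_atLeast0 prod_power_distrib)
    then have X: "[X = - 1] (mod int p)"
      using square_fact_half_cong[OF p pm] by (simp add: n_def)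
    have "[X ^ n = (- 1) ^ n] (mod int p)"
      by (intro cong_pow X)
    then have "[1 = X ^ n] (mod int p)"
      using n(2) by (simp add: cong_sym_eq)
    then have "[X * (1 * V y) = X * (X ^ n * V y)] (mod int p)"
      by (intro cong_mult cong_refl)
    also have "[X * (X ^ n * V y) = X * ((\<Prod>j<n. (- 1) ^ j) * X * V x)] (mod int p)"
    proof (intro cong_mult[OF cong_refl])
      have "[x j * y j = 1] (mod int p)" if "j < n" for j
        using xn[OF that] n unfolding y_def by (cases n) auto
      then show "[X ^ n * V y = (\<Prod>j<n. (- 1) ^ j) * X * V x] (mod int p)"
        unfolding X_def V_def by (rule vandermonde_inverse_cong)
    qed
    also have "X * ((\<Prod>j<n. (- 1) ^ j) * X * V x) = X * X * ((- 1) ^ m * V x)"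
      unfolding n_def prod_lessThan_alternating_sign by simp
    also have "[\<dots> = - 1 * - 1 * ((- 1) ^ m * V x)] (mod int p)"
      by (intro cong_mult X cong_refl)
    finally show ?thesis
      by (simp only: mult_1 minus_mult_minus)
  qed
  have "[D1 p = det (mat n n (\<lambda>(i, j). x j * (\<Sum>a<n. \<gamma> a * x i ^ a * y j ^ a)))] (mod int p)"
    unfolding D1_def D1_mat_def half by (rule det_cong_mod) (rule entry)
  also have "det (mat n n (\<lambda>(i, j). x j * (\<Sum>a<n. \<gamma> a * x i ^ a * y j ^ a))) =
      X * (\<Prod>a<n. \<gamma> a) * V x * V y"
    unfolding V_def X_def by (rule det_power_kernel)
  also have "(\<Prod>a<n. \<gamma> a) = (- 1) ^ m * c\<^sup>2"
    unfolding \<gamma>_def c_def n_def by (rule binomial_coefficient_prod[OF mq])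
  also have "X * ((- 1) ^ m * c\<^sup>2) * V x * V y = (- 1) ^ m * c\<^sup>2 * V x * (X * V y)"
    by simp
  also have "[\<dots> = (- 1) ^ m * c\<^sup>2 * V x * ((- 1) ^ m * V x)] (mod int p)"
    by (intro cong_mult[OF cong_refl] XV)
  also have "(- 1) ^ m * c\<^sup>2 * V x * ((- 1) ^ m * V x) = (V x * c)\<^sup>2"
    by (simp add: power2_eq_square)
  finally show ?thesis
    by (simp only: V_def x_def c_def n_def)
qed

text \<open>The two roots agree up to sign modulo \<open>p\<close>, and the symbol of -1 is 1
  because (p - 1)/2 is even.\<close>

lemma Legendre_eq_if_square_cong:
  assumes "prime p" "[p = 1] (mod 4)" "2 < p" "[s\<^sup>2 = t\<^sup>2] (mod int p)"
  shows "Legendre s (int p) = Legendre t (int p)"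
proof -
  have "even ((p - 1) div 2)"
    using assms(2) unfolding cong_def by presburger
  then have "Legendre (- 1) (int p) = 1"
    by (intro Legendre_eqI assms) auto
  then have neg: "Legendre (- t) (int p) = Legendre t (int p)"
    using Legendre_mult[of p "- 1" t] assms by simp
  have "int p dvd (s - t) * (s + t)"
    using assms(4) by (simp add: cong_iff_dvd_diff power2_eq_square algebra_simps)
  then have "[s = t] (mod int p) \<or> [s = - t] (mod int p)"
    using assms(1) by (simp add: prime_dvd_mult_iff cong_iff_dvd_diff)
  then show ?thesis
    using Legendre_cong[OF assms(1,3)] neg by metis
qed

text \<open>The symbol is an even function, so d times the symbol of d is odd and the matrix is
  alternating. This ensures that \<open>int_sqrt\<close> has a specified value at
  \<open>D1 p\<close>.\<close>

lemma D1_square: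
  assumes "prime p" "[p = 1] (mod 4)" "2 < p"
  shows "\<exists>s. D1 p = s\<^sup>2"
proof -
  define f where "f i j = (let d = (int (Suc i))\<^sup>2 - (int (Suc j))\<^sup>2 in d * Legendre d (int p))" for i j
  have "Legendre (a - b) (int p) = Legendre (b - a) (int p)" for a b
    by (rule Legendre_eq_if_square_cong[OF assms]) (simp add: power2_commute)
  then have "f j i = - f i j" for i j
    unfolding f_def Let_def by (metis minus_diff_eq mult_minus_left)
  then show ?thesis
    unfolding D1_def D1_mat_def f_def[symmetric]
    by (rule int_det_alternating_is_square[rotated]) (simp add: f_def)
qed

text \<open>Since n + 1 and n + 2 are congruent to 1/2 and 3/2, the symbol of n + 2 is that of n + 1
  times that of 3. The factor n + 1 then completes the product of binomial coefficients.\<close>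

lemma Legendre_square_root:
  assumes p: "prime p" and pm: "p = 4 * m + 1" and mq: "m = Suc q"
  shows "Legendre ((\<Prod>j<2 * m. \<Prod>i<j. (int (Suc j))\<^sup>2 - (int (Suc i))\<^sup>2) *
      (int (2 * m + 2) * (\<Prod>k<q. int (Suc (2 * m) choose (k + 2))))) (int p) =
    Legendre (fact m) (int p) * Legendre 3 (int p)"
proof -
  define n where "n = 2 * m"
  define \<chi> where "\<chi> a = Legendre a (int p)" for a
  define V where "V = (\<Prod>j<n. \<Prod>i<j. (int (Suc j))\<^sup>2 - (int (Suc i))\<^sup>2)"
  define R where "R = (\<Prod>k<q. int (Suc n choose (k + 2)))"
  have p2: "2 < p" and np: "Suc n < p" and n: "even n" using pm mq by (simp_all add: n_def)
  have mult: "\<chi> (a * b) = \<chi> a * \<chi> b" for a b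
    unfolding \<chi>_def by (rule Legendre_mult[OF p p2])
  have prod: "\<chi> (\<Prod>i\<in>S. f i) = (\<Prod>i\<in>S. \<chi> (f i))" for S and f :: "nat \<Rightarrow> int"
    unfolding \<chi>_def by (rule Legendre_prod[OF p p2])
  have fact_sq: "\<chi> (fact k) * \<chi> (fact k) = 1" if "k < p" for k
    unfolding \<chi>_def by (intro Legendre_unit_square not_dvd_fact_int p that)
  have one: "\<chi> 1 = 1"
    unfolding \<chi>_def by (rule Legendre_1[OF p p2])
  have two: "\<chi> 2 * \<chi> 2 = 1"
    using fact_sq[of 2] p2 by (simp add: fact_numeral)
  have square_cong: "\<chi> s = \<chi> t" if "[s\<^sup>2 = t\<^sup>2] (mod int p)" for s t
    unfolding \<chi>_def using pm by (intro Legendre_eq_if_square_cong p p2 that) (simp add: cong_def)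
  have sign: "\<chi> ((- 1) ^ k) = 1" for k
    using square_cong[of "(- 1) ^ k" 1] one by (simp add: power2_eq_square)
  have n1: "\<chi> (int (n + 1)) = \<chi> 2"
  proof -
    have "[2 * int (n + 1) = 1] (mod int p)"
      using pm by (simp add: n_def cong_iff_dvd_diff)
    then have "\<chi> (2 * int (n + 1)) = \<chi> 1"
      unfolding \<chi>_def by (rule Legendre_cong[OF p p2])
    then have "\<chi> 2 * \<chi> (int (n + 1)) = 1"
      by (simp only: mult one)
    then have "\<chi> 2 * \<chi> 2 * \<chi> (int (n + 1)) = \<chi> 2"
      by (simp only: mult.assoc mult_1_right)
    then show ?thesis using two by simp
  qed
  have n2: "\<chi> (int (n + 2)) = \<chi> 2 * \<chi> 3"
  proof -
    have "[2 * int (n + 2) = 3] (mod int p)"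
      using pm by (simp add: n_def cong_iff_dvd_diff)
    then have "\<chi> (2 * int (n + 2)) = \<chi> 3"
      unfolding \<chi>_def by (rule Legendre_cong[OF p p2])
    then have "\<chi> 2 * \<chi> (int (n + 2)) = \<chi> 3"
      by (simp only: mult)
    then have "\<chi> 2 * \<chi> 2 * \<chi> (int (n + 2)) = \<chi> 2 * \<chi> 3"
      by (simp only: mult.assoc)
    then show ?thesis using two by simp
  qed
  \<comment> \<open>Euler's criterion with (p - 1)/2 = 2m reduces this to the m-th power of (n!)^2,
    which is congruent to -1.\<close>
  have fn: "\<chi> (fact n) = (- 1) ^ m"
    unfolding \<chi>_def
  proof (rule Legendre_eqI[OF p p2])
    have "[((fact n)\<^sup>2) ^ m = (- 1) ^ m] (mod int p)"
      using square_fact_half_cong[OF p pm] unfolding n_def by (rule cong_pow)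
    moreover have "(p - 1) div 2 = 2 * m" using pm by simp
    ultimately show "[(- 1) ^ m = fact n ^ ((p - 1) div 2)] (mod int p)"
      by (simp add: power_mult cong_sym_eq)
  qed simp
  have fn1: "\<chi> (fact (Suc n)) = \<chi> 2 * \<chi> (fact n)"
  proof -
    have "fact (Suc n) = int (n + 1) * fact n" by simp
    then show ?thesis by (simp only: mult n1)
  qed
  \<comment> \<open>The arguments 2j + 1 and 2(n - 1 - j) + 1 add up to p - 1, so by Wilson the
    paired factorials multiply to 1 or -1, both of symbol 1.\<close>
  have V: "\<chi> V = \<chi> (fact n)"
  proof -
    have "\<chi> V * \<chi> (fact n) = (\<Prod>j<n. \<chi> (fact (2 * j + 1)))"
      unfolding V_def mult[symmetric] prod[symmetric] vandermonde_squares_mult_fact ..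
    also have "\<dots> = (\<Prod>j<m. \<chi> (fact (2 * j + 1)) * \<chi> (fact (2 * (n - 1 - j) + 1)))"
      unfolding n_def by (rule prod_lessThan_fold)
    also have "\<dots> = 1"
    proof (rule prod.neutral, rule ballI)
      fix j assume j: "j \<in> {..<m}"
      have e: "p - 1 - (2 * j + 1) = 2 * (n - 1 - j) + 1" and "2 * j + 1 < p"
        using j pm by (auto simp: n_def)
      then have "[fact (2 * j + 1) * fact (2 * (n - 1 - j) + 1) = (- 1) ^ Suc (2 * j + 1)] (mod int p)"
        using fact_mult_fact_complement_cong[OF p, of "2 * j + 1"] unfolding e by simp
      then have "\<chi> (fact (2 * j + 1) * fact (2 * (n - 1 - j) + 1)) = \<chi> ((- 1) ^ Suc (2 * j + 1))"
        unfolding \<chi>_def by (rule Legendre_cong[OF p p2])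
      then show "\<chi> (fact (2 * j + 1)) * \<chi> (fact (2 * (n - 1 - j) + 1)) = 1"
        by (simp only: mult sign)
    qed
    finally have "\<chi> V * (\<chi> (fact n) * \<chi> (fact n)) = \<chi> (fact n)" by simp
    then show ?thesis using fact_sq[of n] np by simp
  qed
  \<comment> \<open>With n + 1 as the coefficient of lower index 1, the lower indices are 1, ..., m.
    The factorials (k + 1)! and (n - k)! in the denominators then run through 1!, ..., n! exactly
    once.\<close>
  have T: "\<chi> (int (n + 1)) * \<chi> R = \<chi> (fact n) ^ m * \<chi> (fact m)"
  proof -
    have binom: "\<chi> (int (Suc n choose Suc k)) = \<chi> (fact (Suc n)) * (\<chi> (fact (Suc k)) * \<chi> (fact (n - k)))"
      if "k < m" for k
    proof -
      have k: "k \<le> n" using that by (simp add: n_def)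
      have "int (fact (Suc k) * fact (n - k) * (Suc n choose Suc k)) = int (fact (Suc n))"
        using binomial_fact_lemma[of "Suc k" "Suc n"] k by simp
      then have "fact (Suc k) * fact (n - k) * int (Suc n choose Suc k) = fact (Suc n)"
        by (simp only: of_nat_mult of_nat_fact)
      then have "\<chi> (fact (Suc n)) = \<chi> (fact (Suc k)) * \<chi> (fact (n - k)) * \<chi> (int (Suc n choose Suc k))"
        by (metis mult)
      \<comment> \<open>The symbols of these factorials are 1 or -1, so dividing by them is
        multiplying by them.\<close>
      then have "\<chi> (fact (Suc n)) * (\<chi> (fact (Suc k)) * \<chi> (fact (n - k))) =
          (\<chi> (fact (Suc k)) * \<chi> (fact (Suc k))) * (\<chi> (fact (n - k)) * \<chi> (fact (n - k))) *
          \<chi> (int (Suc n choose Suc k))"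
        by (simp only: ac_simps)
      then show ?thesis
        using fact_sq[of "Suc k"] fact_sq[of "n - k"] np k by (simp del: fact_Suc binomial_Suc_Suc)
    qed
    have "\<chi> (int (n + 1)) * \<chi> R = (\<Prod>k<m. \<chi> (int (Suc n choose Suc k)))"
      unfolding mq prod.lessThan_Suc_shift R_def prod by simp
    also have "\<dots> = (\<Prod>k<m. \<chi> (fact (Suc n)) * (\<chi> (fact (Suc k)) * \<chi> (fact (n - k))))"
      by (intro prod.cong refl binom) simp
    also have "\<dots> = \<chi> (fact (Suc n)) ^ m * (\<Prod>k<m. \<chi> (fact (Suc k)) * \<chi> (fact (n - k)))"
      by (subst prod.distrib) simp
    also have "(\<Prod>k<m. \<chi> (fact (Suc k)) * \<chi> (fact (n - k))) = (\<Prod>k<2 * m. \<chi> (fact (k + 1)))"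
      unfolding prod_lessThan_fold by (intro prod.cong) (auto simp: n_def Suc_diff_Suc simp del: fact_Suc)
    also have "\<dots> = \<chi> 2 ^ m * \<chi> (fact m)"
      unfolding \<chi>_def using np by (intro Legendre_prod_fact p p2) (simp add: n_def)
    also have "\<chi> (fact (Suc n)) ^ m * (\<chi> 2 ^ m * \<chi> (fact m)) = (\<chi> 2 * \<chi> 2) ^ m * \<chi> (fact n) ^ m * \<chi> (fact m)"
      unfolding fn1 by (simp only: power_mult_distrib ac_simps)
    finally show ?thesis using two by simp
  qed
  have "\<chi> (V * (int (n + 2) * R)) = \<chi> (fact n) * \<chi> 3 * (\<chi> (int (n + 1)) * \<chi> R)"
    unfolding mult V n1 n2 by (simp only: ac_simps)
  also have "\<dots> = \<chi> (fact n) ^ Suc m * (\<chi> (fact m) * \<chi> 3)"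
    unfolding T by simp
  \<comment> \<open>The exponent of -1 is m (m + 1), which is even.\<close>
  also have "\<chi> (fact n) ^ Suc m = 1"
    unfolding fn by (cases "even m") simp_all
  finally show ?thesis
    by (simp add: \<chi>_def V_def R_def n_def)
qed

text \<open>The sign in quadratic reciprocity is trivial because (p - 1)/2 is even; p = 3 is
  excluded by the residue of \<open>p\<close> modulo 4.\<close>

lemma Legendre_3_reciprocity:
  assumes "prime p" "[p = 1] (mod 4)" "2 < p"
  shows "Legendre 3 (int p) = Legendre (int p) 3"
proof -
  have "p \<noteq> 3" and "even ((p - 1) div 2)"
    using assms(2) unfolding cong_def by (auto, presburger)
  then have "Legendre (int p) 3 * Legendre 3 (int p) = 1"
    using Quadratic_Reciprocity[of p 3] assms by simp
  then show ?thesis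
    by (metis zmult_eq_1_iff)
qed

theorem theorem1p4:
  fixes p :: nat
  assumes "prime p" and "[p = 1] (mod 4)"
  shows "Legendre (int_sqrt (D1 p)) (int p) =
    (-1) ^ card {k :: int. 0 < k \<and> real_of_int k < real p / 4 \<and> Legendre k (int p) = -1}
      * Legendre (int p) 3"
proof -
  define m where "m = p div 4"
  have pm: "p = 4 * m + 1"
    using assms(2) unfolding m_def cong_def by presburger
  have "m \<noteq> 0" using pm assms(1) by (intro notI) simp
  then obtain q where mq: "m = Suc q" by (metis not0_implies_Suc)
  have p2: "2 < p" using pm mq by simp
  obtain r where r: "D1 p = r\<^sup>2"
    using D1_square[OF assms p2] by blast
  then have "int_sqrt (D1 p) = \<bar>r\<bar>"
    using int_sqrt_power2[of "\<bar>r\<bar>"] by simp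
  moreover have "[\<bar>r\<bar>\<^sup>2 = ((\<Prod>j<2 * m. \<Prod>i<j. (int (Suc j))\<^sup>2 - (int (Suc i))\<^sup>2) *
      (int (2 * m + 2) * (\<Prod>k<q. int (Suc (2 * m) choose (k + 2)))))\<^sup>2] (mod int p)"
    using D1_cong_square[OF assms(1) pm mq] unfolding r power2_abs .
  ultimately have "Legendre (int_sqrt (D1 p)) (int p) = Legendre (fact m) (int p) * Legendre 3 (int p)"
    using Legendre_eq_if_square_cong[OF assms p2] Legendre_square_root[OF assms(1) pm mq] by simp
  moreover have "Legendre (fact m) (int p) =
      (-1) ^ card {k :: int. 0 < k \<and> real_of_int k < real p / 4 \<and> Legendre k (int p) = -1}"
  proof -
    have "{k :: int. 0 < k \<and> real_of_int k < real p / 4 \<and> Legendre k (int p) = -1} =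
        int ` {k. 0 < k \<and> k \<le> m \<and> Legendre (int k) (int p) = - 1}" (is "?K = int ` ?N")
    proof -
      \<comment> \<open>Here p/4 = m + 1/4, so for integers the strict bound means k \<le>
        m.\<close>
      have "real_of_int k < real p / 4 \<longleftrightarrow> k \<le> int m" for k
        unfolding pm by (simp add: field_simps) linarith
      then have K: "?K = {k. 0 < k \<and> k \<le> int m \<and> Legendre k (int p) = - 1}"
        by (simp only:)
      show ?thesis
        unfolding K
      proof (intro equalityI subsetI)
        fix k assume "k \<in> {k. 0 < k \<and> k \<le> int m \<and> Legendre k (int p) = - 1}"
        then show "k \<in> int ` ?N"
          by (intro image_eqI[of _ _ "nat k"]) auto
      qed auto
    qed
    then have "card ?K = card ?N"
      by (simp add: card_image)
    then show ?thesis
      using Legendre_fact_eq_sign[OF assms(1) p2, of m] pm by simp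
  qed
  ultimately show ?thesis
    using Legendre_3_reciprocity[OF assms p2] by simp
qed

end
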